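(* Let $p$ be an odd prime and $m,r$ positive integers. Then $S_{mp^r-1}\equiv(-1)^{\frac{p-1}{2}}S_{mp^{r-1}-1}\pmod{p^r}$.
   Context: $(S_n)_{n\ge0}$ is the integer sequence defined by $S_0=1$, $S_1=4$ and $(n+1)^2S_{n+1}=4(3n^2+3n+1)S_n-32n^2S_{n-1}$ for $n\ge1$; equivalently $S_n=\sum_{k=0}^n\binom nk\binom{2k}k\binom{2n-2k}{n-k}$. *)

theory Defs
  imports "HOL-Number_Theory.Number_Theory"
begin

definition S :: "nat \<Rightarrow> int" where
  "S n = (\<Sum>k = 0..n. int (n choose k) * int ((2*k) choose k) * int ((2*n - 2*k) choose (n - k)))"

end

theory Submission
  imports Defs
begin

text \<open>
  Write \<open>n = N - 1\<close> with \<open>N = m p\<^sup>r\<close>, let \<open>i + k = n\<close>, and put \<open>a\<^sub>j = (2i choose i+j)\<close>,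
  \<open>b\<^sub>j = (2k choose k+j)\<close>. The telescoping sum of \<open>a\<^sub>j b\<^sub>j - a\<^sub>j\<^sub>+\<^sub>1 b\<^sub>j\<^sub>+\<^sub>1\<close> shows that \<open>N\<close> divides
  \<open>(2i+1)(2k+1) (2i choose i)(2k choose k)\<close>. As \<open>(2i+1) + (2k+1) = 2N\<close>, every summand of
  \<open>S n\<close> with \<open>p\<close> not dividing \<open>2i+1\<close> vanishes modulo \<open>p\<^sup>r\<close>. The remaining indices are
  \<open>i = p i' + (p-1)/2\<close>; there the reflection \<open>u \<mapsto> N - u\<close> on the \<open>p\<close>-free parts of the factorials
  shows that the summand is congruent to \<open>(-1)\<^bsup>(p-1)/2\<^esup>\<close> times the summand of index \<open>i'\<close> for \<open>N/p\<close>.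
\<close>

section \<open>Divisibility of products of central binomial coefficients\<close>

text \<open>With \<open>c\<close> the coefficient on the right, absorption gives
  \<open>(2i+1) (2i choose i+j) = (i+j+1) c\<close>, and by Pascal's rule the two coefficients on
  the left add up to \<open>c\<close>.\<close>

lemma binomial_middle_diff:
  "(2 * int i + 1) * (int ((2*i) choose (i+j)) - int ((2*i) choose (i+j+1)))
   = (2 * int j + 1) * int ((2*i+1) choose (i+j+1))"
proof -
  define c where "c = int ((2*i+1) choose (i+j+1))"
  have "Suc (2*i) * ((2*i) choose (i+j)) = (Suc (2*i) choose Suc (i+j)) * Suc (i+j)"
    by (rule Suc_times_binomial_eq)
  then have "int (Suc (2*i) * ((2*i) choose (i+j))) = int ((Suc (2*i) choose Suc (i+j)) * Suc (i+j))"
    by (rule arg_cong)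
  then have 1: "(2 * int i + 1) * int ((2*i) choose (i+j)) = (int i + int j + 1) * c"
    unfolding c_def by (simp add: algebra_simps del: binomial_Suc_Suc)
  have "c = int ((2*i) choose (i+j)) + int ((2*i) choose (i+j+1))"
    unfolding c_def by simp
  then have 2: "int ((2*i) choose (i+j+1)) = c - int ((2*i) choose (i+j))" by simp
  show ?thesis
    unfolding c_def[symmetric] 2 using 1 by (simp add: algebra_simps)
qed

lemma dvd_odd_times_central_binomials:
  "int (i + k + 1) dvd (2 * int i + 1) * (2 * int k + 1) * (int ((2*i) choose i) * int ((2*k) choose k))"
proof -
  define a where "a j = int ((2*i) choose (i+j))" for j
  define b where "b j = int ((2*k) choose (k+j))" for j
  define P where "P = (2 * int i + 1) * (2 * int k + 1)"
  have step: "int (i + k + 1) dvd P * (a j * b j - a (j+1) * b (j+1))" for j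
  proof -
    define c where "c = int ((2*i+1) choose (i+j+1))"
    define d where "d = int ((2*k+1) choose (k+j+1))"
    have c: "c = a j + a (j+1)" and d: "d = b j + b (j+1)"
      unfolding c_def d_def a_def b_def by simp_all
    have da: "(2 * int i + 1) * (a j - a (j+1)) = (2 * int j + 1) * c"
      using binomial_middle_diff[of i j] unfolding a_def c_def by (simp add: add.assoc)
    have db: "(2 * int k + 1) * (b j - b (j+1)) = (2 * int j + 1) * d"
      using binomial_middle_diff[of k j] unfolding b_def d_def by (simp add: add.assoc)
    \<comment> \<open>Polarisation: \<open>2(xy - x'y') = (x+x')(y-y') + (x-x')(y+y')\<close>. Both
      differences yield the same factor \<open>2j+1\<close>, so the two products combine through
      \<open>(2i+1) + (2k+1) = 2(i+k+1)\<close>.\<close>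
    have "2 * (P * (a j * b j - a (j+1) * b (j+1)))
        = (2 * int k + 1) * d * ((2 * int i + 1) * (a j - a (j+1)))
        + (2 * int i + 1) * c * ((2 * int k + 1) * (b j - b (j+1)))"
      unfolding P_def c d by (simp add: algebra_simps)
    also have "\<dots> = 2 * (int (i + k + 1) * ((2 * int j + 1) * c * d))"
      unfolding da db by (simp add: algebra_simps)
    finally have "P * (a j * b j - a (j+1) * b (j+1)) = int (i + k + 1) * ((2 * int j + 1) * c * d)"
      by simp
    then show ?thesis by simp
  qed
  have "int (i + k + 1) dvd P * (a 0 * b 0 - a J * b J)" for J
  proof (induction J)
    case (Suc J)
    have "P * (a 0 * b 0 - a (Suc J) * b (Suc J))
        = P * (a 0 * b 0 - a J * b J) + P * (a J * b J - a (J+1) * b (J+1))"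
      by (simp add: algebra_simps)
    then show ?case using Suc step[of J] by (metis dvd_add)
  qed simp
  \<comment> \<open>At \<open>J = i+1\<close> the boundary term vanishes, since
    \<open>a (i+1)\<close> is \<open>2i choose 2i+1\<close>.\<close>
  from this[of "i+1"] show ?thesis
    unfolding a_def b_def P_def by (simp add: binomial_eq_0)
qed

section \<open>Factorials without the multiples of p\<close>

text \<open>For prime \<open>p\<close> this is, up to sign, the value of Morita's p-adic gamma
  function at \<open>n + 1\<close>. Being coprime to \<open>p\<close>, it can be cancelled modulo
  powers of \<open>p\<close>.\<close>

definition pfree_fact :: "nat \<Rightarrow> nat \<Rightarrow> int" where
  "pfree_fact p n = (\<Prod>u = 1..n. if p dvd u then 1 else int u)"

lemma pfree_fact_0 [simp]: "pfree_fact p 0 = 1"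
  by (simp add: pfree_fact_def)

lemma pfree_fact_Suc:
  "pfree_fact p (Suc n) = pfree_fact p n * (if p dvd Suc n then 1 else int (Suc n))"
  by (simp add: pfree_fact_def)

lemma coprime_pfree_fact:
  assumes "prime p" shows "coprime (pfree_fact p n) (int p ^ r)"
proof -
  have "coprime (pfree_fact p n) (int p)"
    unfolding pfree_fact_def
  proof (rule prod_coprime_left)
    fix u
    show "coprime (if p dvd u then 1 else int u) (int p)"
      using assms by (auto simp: coprime_commute prime_imp_coprime)
  qed
  then show ?thesis by simp
qed

text \<open>The multiples of \<open>p\<close> up to \<open>n\<close> are \<open>p * v\<close> with
  \<open>1 \<le> v \<le> n div p\<close>; they account for the first two factors.\<close>

lemma fact_eq_pfree_fact:
  assumes "p > 0"
  shows "(fact n :: int) = int p ^ (n div p) * fact (n div p) * pfree_fact p n"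
proof (induction n)
  case (Suc n)
  show ?case
  proof (cases "p dvd Suc n")
    case True
    then have d: "Suc n div p = Suc (n div p)" using assms
      by (simp add: div_Suc dvd_eq_mod_eq_0)
    have "int (Suc n) = int p * int (Suc (n div p))"
      using True d by (metis dvd_mult_div_cancel of_nat_mult)
    moreover have "(fact (Suc n) :: int) = int (Suc n) * fact n"
      and "(fact (Suc (n div p)) :: int) = int (Suc (n div p)) * fact (n div p)"
      by simp_all
    ultimately show ?thesis
      unfolding d pfree_fact_Suc Suc.IH using True by (simp only: power_Suc mult_ac if_True mult_1_left mult_1_right)
  next
    case False
    then have d: "Suc n div p = n div p"
      by (simp add: div_Suc dvd_eq_mod_eq_0)
    have "(fact (Suc n) :: int) = int (Suc n) * fact n" by simp
    then show ?thesis
      unfolding d pfree_fact_Suc Suc.IH using False by simp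
  qed
qed simp

text \<open>Factors move one at a time from \<open>b\<close> to \<open>a\<close>: modulo
  \<open>q\<close>, \<open>Suc b\<close> is \<open>- Suc a\<close>, and \<open>p\<close> divides
  both or neither. Each factor prime to \<open>p\<close> costs a sign, and
  \<open>b - b div p\<close> counts these. The modulus is any divisor of \<open>N\<close>, so that
  the reflection can also be made at \<open>2 * N\<close>.\<close>

lemma pfree_fact_reflect:
  assumes "prime p" and "p dvd N" and "q dvd int N" and "a + b + 1 = N"
  shows "[pfree_fact p a * pfree_fact p b = (-1) ^ (b - b div p) * pfree_fact p (N - 1)] (mod q)"
  using assms(4)
proof (induction b arbitrary: a)
  case 0
  then show ?case by auto
next
  case (Suc b)
  have IH: "[pfree_fact p (Suc a) * pfree_fact p b = (-1) ^ (b - b div p) * pfree_fact p (N - 1)] (mod q)"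
    using Suc by simp
  have N: "N = Suc a + Suc b" using Suc.prems by simp
  have iff: "p dvd Suc a \<longleftrightarrow> p dvd Suc b"
    using assms(2) unfolding N by (metis dvd_add_left_iff dvd_add_right_iff)
  show ?case
  proof (cases "p dvd Suc b")
    case True
    then have "Suc b div p = Suc (b div p)" by (simp add: div_Suc dvd_eq_mod_eq_0)
    then have "Suc b - Suc b div p = b - b div p" by simp
    then show ?thesis using IH True iff by (simp add: pfree_fact_Suc)
  next
    case False
    then have "Suc b div p = b div p" by (simp add: div_Suc dvd_eq_mod_eq_0)
    then have e: "Suc b - Suc b div p = Suc (b - b div p)"
      by (simp add: Suc_diff_le)
    have "[int (Suc b) = - int (Suc a)] (mod q)"
      using assms(3) unfolding N by (simp add: cong_iff_dvd_diff algebra_simps)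
    then have "[pfree_fact p a * pfree_fact p b * int (Suc b)
          = pfree_fact p a * pfree_fact p b * (- int (Suc a))] (mod q)"
      by (rule cong_scalar_left)
    moreover have "pfree_fact p a * pfree_fact p b * (- int (Suc a))
        = - (pfree_fact p (Suc a) * pfree_fact p b)"
      using False iff by (simp add: pfree_fact_Suc algebra_simps)
    moreover have "[- (pfree_fact p (Suc a) * pfree_fact p b)
        = - ((-1) ^ (b - b div p) * pfree_fact p (N - 1))] (mod q)"
      using IH by (simp only: cong_minus_minus_iff)
    moreover have "pfree_fact p a * pfree_fact p (Suc b) = pfree_fact p a * pfree_fact p b * int (Suc b)"
      using False by (simp add: pfree_fact_Suc)
    ultimately show ?thesis unfolding e by (metis cong_trans power_Suc mult_minus1 mult.assoc)
  qed
qed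

text \<open>The second hypothesis says that adding the lowest base-\<open>p\<close> digits produces
  no carry, so the powers of \<open>p\<close> in the three factorials cancel. The cross-multiplied
  form avoids division.\<close>

lemma binomial_pfree_fact:
  assumes "p > 0" and "(i + k) div p = i div p + k div p"
  shows "int ((i + k) choose i) * (pfree_fact p i * pfree_fact p k)
       = int ((i div p + k div p) choose (i div p)) * pfree_fact p (i + k)"
proof -
  have f: "int (x + y choose x) * (fact x * fact y) = fact (x + y)" for x y :: nat
  proof -
    have "fact x * fact y * (x + y choose x) = (fact (x + y) :: nat)"
      using binomial_fact_lemma[of x "x + y"] by simp
    then have "int (fact x * fact y * (x + y choose x)) = int (fact (x + y))" by simp
    then show ?thesis by (simp add: mult_ac)
  qed
  define X :: int where "X = int p ^ (i div p + k div p) * (fact (i div p) * fact (k div p))"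
  have "X * (int ((i + k) choose i) * (pfree_fact p i * pfree_fact p k)) = fact (i + k)"
    unfolding f[symmetric] X_def fact_eq_pfree_fact[OF assms(1), of i] fact_eq_pfree_fact[OF assms(1), of k]
    by (simp add: power_add mult_ac)
  also have "\<dots> = X * (int ((i div p + k div p) choose (i div p)) * pfree_fact p (i + k))"
    unfolding X_def fact_eq_pfree_fact[OF assms(1), of "i + k"] assms(2) f[of "i div p", symmetric]
    by (simp only: mult_ac)
  finally show ?thesis using assms(1) unfolding X_def by simp
qed

section \<open>Congruences for single summands\<close>

text \<open>Indexing by both \<open>i\<close> and \<open>k\<close>, with \<open>n = i + k\<close>,
  makes the symmetry visible and removes the natural-number subtraction.\<close>

definition S_term :: "nat \<Rightarrow> nat \<Rightarrow> int" where
  "S_term i k = int ((i + k) choose i) * int ((2*i) choose i) * int ((2*k) choose k)"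

lemma S_eq_sum_S_term: "S n = (\<Sum>i<Suc n. S_term i (n - i))"
  unfolding S_def S_term_def
  by (rule sum.cong) (auto simp: diff_mult_distrib2)

lemma S_term_cong_0:
  assumes "prime p" and "int p ^ r dvd int (i + k + 1)" and "r > 0" and "\<not> p dvd 2 * i + 1"
  shows "[S_term i k = 0] (mod int p ^ r)"
proof -
  have pN: "p dvd i + k + 1"
    using assms(2,3) by (metis dvd_power dvd_trans of_nat_dvd_iff)
  \<comment> \<open>As \<open>p\<close> divides this sum, it cannot divide just one of the two odd
    factors; both are therefore units modulo \<open>p ^ r\<close> and can be cancelled.\<close>
  have "(2 * i + 1) + (2 * k + 1) = 2 * (i + k + 1)" by simp
  then have "\<not> p dvd 2 * k + 1"
    using pN assms(4) by (metis dvd_add_left_iff dvd_mult)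
  then have "coprime (int p) (int (2 * i + 1))" "coprime (int p) (int (2 * k + 1))"
    using assms(1,4) prime_imp_coprime coprime_int_iff by blast+
  then have "coprime (int p ^ r) ((2 * int i + 1) * (2 * int k + 1))"
    by (simp add: add.commute)
  moreover have "int p ^ r dvd (2 * int i + 1) * (2 * int k + 1) * (int ((2*i) choose i) * int ((2*k) choose k))"
    using assms(2) dvd_odd_times_central_binomials dvd_trans by blast
  ultimately have "int p ^ r dvd int ((2*i) choose i) * int ((2*k) choose k)"
    by (simp add: coprime_dvd_mult_right_iff)
  then show ?thesis
    unfolding S_term_def cong_0_iff by (simp add: mult.assoc)
qed

text \<open>The lowest digit \<open>h\<close> satisfies \<open>2 * h < p\<close>, so none of the
  three binomials has a carry. Their p-free parts reduce to cubes of one unit \<open>?w\<close>,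
  with sign \<open>(-1) ^ (3 * h) = (-1) ^ h\<close>.\<close>

lemma S_term_cong:
  fixes h :: nat
  assumes "prime p" and p: "p = 2 * h + 1" and q: "int p ^ r dvd int (p * (i + k + 1))"
  shows "[S_term (p * i + h) (p * k + h) = (-1) ^ h * S_term i k] (mod int p ^ r)"
proof -
  define I K N where "I = p * i + h" and "K = p * k + h" and "N = p * (i + k + 1)"
  let ?W = "pfree_fact p" and ?q = "int p ^ r"
  have p0: "p > 0" using p by simp
  have dh: "h < p" and h2: "2 * h < p" using p by simp_all
  have I: "I div p = i" and K: "K div p = k" unfolding I_def K_def using dh by simp_all
  have I2: "2 * I = p * (2 * i) + 2 * h" and K2: "2 * K = p * (2 * k) + 2 * h"
    unfolding I_def K_def by (simp_all add: algebra_simps)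
  have dI2: "(I + I) div p = 2 * i" and dK2: "(K + K) div p = 2 * k"
    unfolding mult_2[symmetric] I2 K2 using h2 by simp_all
  have IK: "I + K + 1 = N" unfolding I_def K_def N_def by (simp add: p algebra_simps)
  have "I + K = p * (i + k) + 2 * h" unfolding I_def K_def by (simp add: algebra_simps)
  then have dIK: "(I + K) div p = i + k" using h2 by simp
  have pN: "p dvd N" and qN: "?q dvd int N" using q by (simp_all add: N_def)
  have eK: "even (K - K div p) = even h"
  proof -
    have "K - K div p = 2 * h * k + h" unfolding K unfolding K_def by (simp add: p algebra_simps)
    then show ?thesis by simp
  qed
  have A: "[?W I * ?W K = (-1) ^ h * ?W (N - 1)] (mod ?q)"
  proof -
    have "(-1 :: int) ^ (K - K div p) = (-1) ^ h" using eK by (simp add: minus_one_power_iff)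
    then show ?thesis using pfree_fact_reflect[OF assms(1) pN qN IK] by simp
  qed
  \<comment> \<open>Here \<open>2I + 2K + 1\<close> is \<open>2N - 1\<close>, one short of what the
    reflection at \<open>2 * N\<close> needs. Since \<open>2I + 1\<close> is a multiple of
    \<open>p\<close>, replacing \<open>2I\<close> by it leaves \<open>?W\<close> unchanged. A second
    reflection at \<open>2 * N\<close>, with the pair \<open>N - 1\<close> and \<open>N\<close>,
    turns \<open>?W (2 * N - 1)\<close> into a square; both signs are even powers of -1.\<close>
  have B: "[?W (I + I) * ?W (K + K) = ?W (N - 1) * ?W (N - 1)] (mod ?q)"
  proof -
    have "p dvd Suc (I + I)"
    proof -
      have "Suc (I + I) = p * (2 * i + 1)" unfolding I_def by (simp add: p algebra_simps)
      then show ?thesis by simp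
    qed
    then have "?W (Suc (I + I)) = ?W (I + I)" by (simp add: pfree_fact_Suc)
    moreover have "even (K + K - (K + K) div p)" unfolding dK2 using eK unfolding K
      by (metis diff_mult_distrib2 dvd_triv_left mult_2)
    moreover have "Suc (I + I) + (K + K) + 1 = 2 * N" using IK by simp
    ultimately have 1: "[?W (I + I) * ?W (K + K) = ?W (2 * N - 1)] (mod ?q)"
      using pfree_fact_reflect[OF assms(1), of "2 * N" ?q "Suc (I + I)" "K + K"] pN qN by simp
    have Npos: "N = Suc (N - 1)" using IK by simp
    then have "?W N = ?W (N - 1)" using pN by (metis mult.right_neutral pfree_fact_Suc)
    moreover have "even (N - N div p)"
    proof -
      have "N div p = i + k + 1" using p0 unfolding N_def by simp
      moreover have "N = 2 * h * (i + k + 1) + (i + k + 1)"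
        unfolding N_def by (simp add: p algebra_simps)
      ultimately have "N - N div p = 2 * h * (i + k + 1)" by simp
      then show ?thesis by simp
    qed
    moreover have "(N - 1) + N + 1 = 2 * N" using Npos by linarith
    ultimately have 2: "[?W (N - 1) * ?W (N - 1) = ?W (2 * N - 1)] (mod ?q)"
      using pfree_fact_reflect[OF assms(1), of "2 * N" ?q "N - 1" N] pN qN by simp
    show ?thesis using 1 2 cong_sym cong_trans by blast
  qed
  let ?w = "?W (N - 1)"
  have "S_term I K * ((?W I * ?W K) * (?W I * ?W K) * (?W I * ?W K))
      = (int ((I + K) choose I) * (?W I * ?W K)) * (int ((I + I) choose I) * (?W I * ?W I))
        * (int ((K + K) choose K) * (?W K * ?W K))"
    unfolding S_term_def mult_2 by (simp add: mult_ac)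
  also have "\<dots> = S_term i k * (?w * (?W (I + I) * ?W (K + K)))"
  proof -
    have w: "?w = ?W (I + K)" using IK by (metis add_diff_cancel_right')
    show ?thesis
      using binomial_pfree_fact[OF p0, of I K] binomial_pfree_fact[OF p0, of I I]
        binomial_pfree_fact[OF p0, of K K] dI2 dK2 dIK
      unfolding I K w S_term_def mult_2 by (simp add: mult_ac)
  qed
  finally have eq: "S_term I K * ((?W I * ?W K) * (?W I * ?W K) * (?W I * ?W K))
      = S_term i k * (?w * (?W (I + I) * ?W (K + K)))" .
  have "[S_term I K * ((?W I * ?W K) * (?W I * ?W K) * (?W I * ?W K))
      = S_term I K * (((-1) ^ h * ?w) * ((-1) ^ h * ?w) * ((-1) ^ h * ?w))] (mod ?q)"
    by (intro cong_mult A cong_refl)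
  moreover have "[S_term i k * (?w * (?W (I + I) * ?W (K + K))) = S_term i k * (?w * (?w * ?w))] (mod ?q)"
    by (intro cong_mult B cong_refl)
  ultimately have "[S_term I K * (((-1) ^ h * ?w) * ((-1) ^ h * ?w) * ((-1) ^ h * ?w))
      = S_term i k * (?w * (?w * ?w))] (mod ?q)"
    unfolding eq using cong_sym cong_trans by blast
  moreover have "S_term I K * (((-1) ^ h * ?w) * ((-1) ^ h * ?w) * ((-1) ^ h * ?w))
      = (-1) ^ h * S_term I K * (?w * (?w * ?w))"
    by (cases "even h") simp_all
  moreover have "coprime (?w * (?w * ?w)) ?q"
    using coprime_pfree_fact[OF assms(1)] by (simp only: coprime_mult_left_iff)
  ultimately have "[(-1) ^ h * S_term I K = S_term i k] (mod ?q)"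
    by (metis cong_mult_rcancel)
  \<comment> \<open>Multiplying by the sign, which is its own inverse, moves it to the other
    side.\<close>
  then have "[(-1) ^ h * ((-1) ^ h * S_term I K) = (-1) ^ h * S_term i k] (mod ?q)"
    by (rule cong_scalar_left)
  moreover have "(-1) ^ h * ((-1) ^ h * S_term I K) = S_term I K"
    by (cases "even h") simp_all
  ultimately show ?thesis unfolding I_def K_def by simp
qed

section \<open>Summation over all indices\<close>

theorem theorem3p3:
  fixes p m r :: nat
  assumes "prime p" and "odd p" and "m > 0" and "r > 0"
  shows "[S (m * p ^ r - 1) = (-1) ^ ((p - 1) div 2) * S (m * p ^ (r - 1) - 1)] (mod (int p ^ r))"
proof -
  define h where "h = (p - 1) div 2"
  define M where "M = m * p ^ (r - 1)"
  have p: "p = 2 * h + 1" using assms(2) unfolding h_def by (elim oddE) simp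
  have p0: "p > 0" using p by simp
  have M0: "M > 0" using assms(3) p0 by (simp add: M_def)
  have N: "m * p ^ r = p * M" using assms(4) unfolding M_def by (cases r) simp_all
  have q: "int p ^ r dvd int (p * M)" unfolding N[symmetric] by simp
  have pM0: "p * M > 0" using p0 M0 by simp
  let ?f = "\<lambda>i. S_term i (p * M - 1 - i)"
  \<comment> \<open>The image of \<open>?g\<close> on \<open>{..<M}\<close> contains every index
    \<open>i < p * M\<close> with \<open>p\<close> dividing \<open>2i + 1\<close>: the cofactor is
    odd, say \<open>2t + 1\<close>, and then \<open>i = p * t + h\<close>.\<close>
  let ?g = "\<lambda>t. p * t + h"
  have sub: "?g ` {..<M} \<subseteq> {..<p * M}"
  proof (rule image_subsetI)
    fix t assume "t \<in> {..<M}"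
    then have "p * Suc t \<le> p * M" by (intro mult_le_mono) auto
    then show "?g t \<in> {..<p * M}" using p by simp
  qed
  have van: "[?f i = 0] (mod int p ^ r)" if i: "i \<in> {..<p * M} - ?g ` {..<M}" for i
  proof (rule S_term_cong_0[OF assms(1) _ assms(4)])
    have "i + (p * M - 1 - i) + 1 = p * M" using i pM0 by auto
    then show "int p ^ r dvd int (i + (p * M - 1 - i) + 1)" using q by (simp only:)
    show "\<not> p dvd 2 * i + 1"
    proof
      assume "p dvd 2 * i + 1"
      then obtain c where c: "2 * i + 1 = p * c" by (elim dvdE)
      then have "odd (p * c)" by (metis odd_two_times_div_two_succ dvd_triv_left even_plus_one_iff)
      then have "odd c" by simp
      then obtain t where t: "c = 2 * t + 1" by (elim oddE)
      have "2 * i + 1 = 2 * (p * t + h) + 1"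
        unfolding c t using p by (simp add: algebra_simps)
      then have it: "i = ?g t" by simp
      have "p * t + h < p * M" using i unfolding it by blast
      then have "p * t < p * M" by linarith
      then have "t < M" by simp
      then show False using i it by blast
    qed
  qed
  have "S (m * p ^ r - 1) = sum ?f {..<p * M}"
    unfolding N S_eq_sum_S_term using pM0 by simp
  also have "[sum ?f {..<p * M} = sum ?f (?g ` {..<M})] (mod int p ^ r)"
  proof -
    have "[sum ?f ({..<p * M} - ?g ` {..<M}) = (\<Sum>i\<in>{..<p * M} - ?g ` {..<M}. 0)] (mod int p ^ r)"
      by (rule cong_sum) (rule van)
    then have "[sum ?f ({..<p * M} - ?g ` {..<M}) = 0] (mod int p ^ r)"
      by (simp only: sum.neutral_const)
    then have "[sum ?f ({..<p * M} - ?g ` {..<M}) + sum ?f (?g ` {..<M})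
        = 0 + sum ?f (?g ` {..<M})] (mod int p ^ r)"
      by (rule cong_add) (rule cong_refl)
    then show ?thesis using sum.subset_diff[OF sub, of ?f] by simp
  qed
  also have "sum ?f (?g ` {..<M}) = (\<Sum>t<M. ?f (?g t))"
    using p0 by (subst sum.reindex) (auto simp: inj_on_def)
  also have "[(\<Sum>t<M. ?f (?g t)) = (\<Sum>t<M. (-1) ^ h * S_term t (M - 1 - t))] (mod int p ^ r)"
  proof (rule cong_sum)
    fix t assume "t \<in> {..<M}"
    then have M: "M = t + (M - 1 - t) + 1" by simp
    define k where "k = M - 1 - t"
    have M': "M = t + k + 1" using M k_def by simp
    \<comment> \<open>The complement of \<open>?g t\<close> again has lowest digit \<open>h\<close>,
      because \<open>p - 1 - h = h\<close>; hence it is \<open>?g k\<close>.\<close>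
    have "p * M = p * t + p * k + 2 * h + 1"
      unfolding M' by (simp add: distrib_left p)
    then have "p * M - 1 - ?g t = p * k + h" by simp
    then show "[?f (?g t) = (-1) ^ h * S_term t (M - 1 - t)] (mod int p ^ r)"
      using S_term_cong[OF assms(1) p, of r t k] q unfolding k_def[symmetric] M' by simp
  qed
  also have "(\<Sum>t<M. (-1) ^ h * S_term t (M - 1 - t)) = (-1) ^ h * S (M - 1)"
    unfolding S_eq_sum_S_term using M0 by (simp add: sum_distrib_left)
  finally show ?thesis unfolding h_def M_def .
qed

end
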